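(* For every $t\in[0,0.363]$, the $4\times4$ matrix \[ A_t=\begin{pmatrix}0&1&-t&t^2\\0&0&1&-t\\0&0&0&1\\0&0&0&0\end{pmatrix} \] satisfies Crouzeix's conjecture, i.e. for every polynomial $p\in\mathbb{C}[z]$, \[ \|p(A_t)\|\le 2\max_{z\in W(A_t)}|p(z)|. \]
   Context: For an $n\times n$ complex matrix $A$, $\|A\|$ is the operator norm induced by the Euclidean norm on $\mathbb{C}^n$, and $W(A)=\{\langle Ax,x\rangle : x\in\mathbb{C}^n,\ \|x\|=1\}$ is the numerical range (a compact convex set). *)

theory Defs
  imports "HOL-Analysis.Analysis" "HOL-Computational_Algebra.Polynomial"
begin

text \<open>The library's \<open>inner\<close> on \<open>complex ^ 'n\<close> is real-valued, so the Hermitian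
  inner product is defined here.\<close>

definition cinner :: "complex ^ 'n \<Rightarrow> complex ^ 'n \<Rightarrow> complex" where
  "cinner x y = (\<Sum>i\<in>UNIV. x $ i * cnj (y $ i))"

text \<open>The library norm on \<open>complex ^ 'n\<close> is the Euclidean one, and \<open>onorm f\<close> is the
  supremum of \<open>norm (f x) / norm x\<close>.\<close>

definition op_norm :: "complex ^ 'n ^ 'n \<Rightarrow> real" where
  "op_norm A = onorm (\<lambda>x. A *v x)"

definition numerical_range :: "complex ^ 'n ^ 'n \<Rightarrow> complex set" where
  "numerical_range A = {cinner (A *v x) x | x. norm x = 1}"

text \<open>The library's \<open>*\<close> and \<open>^\<close> on vectors of vectors are entrywise, hence the separate
  power for the matrix product \<open>**\<close>.\<close>

primrec mat_power :: "complex ^ 'n ^ 'n \<Rightarrow> nat \<Rightarrow> complex ^ 'n ^ 'n" where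
  "mat_power A 0 = mat 1"
| "mat_power A (Suc k) = A ** mat_power A k"

definition poly_mat :: "complex poly \<Rightarrow> complex ^ 'n ^ 'n \<Rightarrow> complex ^ 'n ^ 'n" where
  "poly_mat p A = (\<Sum>k\<le>degree p. (\<chi> i j. coeff p k * mat_power A k $ i $ j))"

definition A_mat :: "real \<Rightarrow> complex ^ 4 ^ 4" where
  "A_mat t = vector [
     vector [0, 1, - of_real t, (of_real t)\<^sup>2],
     vector [0, 0, 1,           - of_real t],
     vector [0, 0, 0,           1],
     vector [0, 0, 0,           0]]"

lemma compact_numerical_range: "compact (numerical_range A)"
proof -
  have "numerical_range A = (\<lambda>x. cinner (A *v x) x) ` sphere 0 1"
    by (auto simp: numerical_range_def)
  moreover have "continuous_on (sphere 0 1) (\<lambda>x. cinner (A *v x) x)"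
    unfolding cinner_def matrix_vector_mult_def by (auto intro!: continuous_intros)
  ultimately show ?thesis
    by (metis compact_continuous_image compact_sphere)
qed

lemma numerical_range_nonempty:
  fixes A :: "complex ^ 'n ^ 'n"
  shows "numerical_range A \<noteq> {}"
proof -
  have "norm (axis undefined 1 :: complex ^ 'n) = 1" by (simp add: norm_axis_1)
  then show ?thesis unfolding numerical_range_def by blast
qed

text \<open>The supremum of \<open>|p|\<close> over the numerical range is therefore a maximum.\<close>

lemma SUP_numerical_range_attained:
  fixes p :: "complex poly" and A :: "complex ^ 'n ^ 'n"
  obtains w where "w \<in> numerical_range A"
    and "\<And>z. z \<in> numerical_range A \<Longrightarrow> cmod (poly p z) \<le> cmod (poly p w)"
    and "(SUP z\<in>numerical_range A. cmod (poly p z)) = cmod (poly p w)"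
proof -
  have "continuous_on (numerical_range A) (\<lambda>z. cmod (poly p z))"
    by (intro continuous_intros)
  then obtain w where w: "w \<in> numerical_range A"
      "\<And>z. z \<in> numerical_range A \<Longrightarrow> cmod (poly p z) \<le> cmod (poly p w)"
    using continuous_attains_sup[OF compact_numerical_range numerical_range_nonempty] by blast
  moreover have "(SUP z\<in>numerical_range A. cmod (poly p z)) = cmod (poly p w)"
    using w by (intro cSup_eq_maximum) auto
  ultimately show thesis using that by blast
qed

end

(* Write N for the nilpotent shift, so that A_t = N (1 + t N)^-1.  After a change of basis with
   condition number at most 2, A_t becomes multiplication by k(v) = v / (5/4 + kappa v) on polynomials
   modulo v^4, where kappa = 17 t / 25.  Multiplication modulo v^4 is a compression of multiplication
   on the unit circle, so |p(A_t)| is at most twice the maximum of |p| over the disc D = k(unit disc).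

   The disc D lies in the numerical range, which is convex (Toeplitz-Hausdorff): for every direction
   eta a trial vector (1 + t N) y with y_k = omega^k g_k, g real, reduces the comparison of support
   functions to a real tridiagonal quadratic form, hence to a polynomial inequality in t and C = Re eta.
   That polynomial is quartic in C; its values at C = 1 and C = -1 factor because the Hermitian part of
   A_t is a real symmetric Toeplitz matrix, which splits under reversal of the basis. *)

theory Submission
  imports Defs "HOL-Complex_Analysis.Cauchy_Integral_Theorem"
begin

section \<open>The polynomial inequality behind the support comparison\<close>

text \<open>The quantities d, e, m carry an extra factor u w (and e its square), which clears the denominators of
  the centre and the radius of the disc D.\<close>

lemma support_gap_poly:
  fixes t C :: real
  assumes t: "0 \<le> t" "t \<le> 363/1000" and C: "\<bar>C\<bar> \<le> 1"
  defines "w \<equiv> 5/4 + 17*t/25" and "u \<equiv> 5/4 - 17*t/25"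
  defines "m \<equiv> 5/4 - 17*t/25*C"
  defines "d \<equiv> m*(1+t^2) - t*C*(u*w)"
  defines "e \<equiv> (u*w)^2/4 + m*t*(m*t - C*(u*w))"
  shows "0 \<le> e*(d^2 - e) - m*d*(d^2 - 2*e)"
proof -
  \<comment> \<open>G1 and G2 are the values of the claimed quantity at C = 1 and C = - 1; subtracting the chord through
    them leaves 1 - C^2 times the quadratic in C below.\<close>
  define G1 where "G1 = u^4/16 * ((w^2*(1-t)^2 - (2-w*t^2)*(2-w)) * ((2+w*t^2)*(2+w) - w^2*(1+t)^2))"
  define G2 where "G2 = w^4/16 * ((u^2*(1+t)^2 - (2-u*t^2)*(2-u)) * ((2+u*t^2)*(2+u) - u^2*(1-t)^2))"
  \<comment> \<open>With \<kappa> = 17t/25 these are 5 \<kappa>^3 and \<kappa>^4.\<close>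
  define q3 where "q3 = (4913/3125)*t^3"
  define q4 where "q4 = (83521/390625)*t^4"
  define q2 where "q2 = (4595431/6553600)*t^2 + (199049753/128000000)*t^4 + (1354036383/250000000000)*t^6
     - (856006729/24414062500)*t^8 - (386201104/152587890625)*t^10"
  have w: "5/4 \<le> w" "w \<le> 3/2" and u: "1 \<le> u" "u \<le> 5/4"
    using t by (auto simp: w_def u_def)
  have t2: "0 \<le> t^2" "t^2 \<le> (363/1000)^2"
    using t by (auto intro!: power_mono)
  have t3: "0 \<le> t^3" "t^3 \<le> (363/1000)^2*t"
    using t mult_right_mono[OF t2(2) t(1)] by (auto simp: power3_eq_cube power2_eq_square)
  \<comment> \<open>Up to sign and a factor 4, the two factors of \<open>G1\<close> are the
    determinants of w H - 1 on the vectors symmetric and antisymmetric under reversal, where H is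
    the Hermitian part of A_t.\<close>
  have "0 \<le> G1"
  proof -
    have *: "w^2*(1-t)^2 - (2-w*t^2)*(2-w) = 1/16 - 13/200*t - 547/1250*t^2 + 272/625*t^3"
      unfolding w_def by algebra
    \<comment> \<open>At t = 363/1000 the cubic is only about 0.002, so it is compared with this
      endpoint value; the difference contains the factor 363/1000 - t.\<close>
    have a: "0 \<le> (363/1000 - t) * (13/200 + 547/1250*(t+363/1000) - 272/625*(t^2+t*(363/1000)+(363/1000)^2))"
    proof (rule mult_nonneg_nonneg)
      show "0 \<le> 13/200 + 547/1250*(t+363/1000) - 272/625*(t^2+t*(363/1000)+(363/1000)^2)"
      proof -
        have "t^2 \<le> 14/100" "(363/1000)^2 \<le> (14/100 :: real)"
          using t2(2) by (auto simp: power2_eq_square)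
        with t show ?thesis by argo
      qed
    qed (use t in simp)
    have b: "1/16 - 13/200*t - 547/1250*t^2 + 272/625*t^3 =
        (a - t) * (13/200 + 547/1250*(t+a) - 272/625*(t^2+t*a+a^2))
        + (1/16 - 13/200*a - 547/1250*a^2 + 272/625*a^3)" for a :: real
      by algebra
    have c: "0 \<le> 1/16 - 13/200*(363/1000::real) - 547/1250*(363/1000)^2 + 272/625*(363/1000)^3"
      by (simp add: power2_eq_square power3_eq_cube)
    have "0 \<le> w^2*(1-t)^2 - (2-w*t^2)*(2-w)"
      unfolding * b[of "363/1000"] by (rule add_nonneg_nonneg[OF a c])
    moreover have "0 \<le> (2+w*t^2)*(2+w) - w^2*(1+t)^2"
    proof -
      have "w^2*(1+t)^2 \<le> (3/2)^2 * (1363/1000)^2"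
        using t w by (intro mult_mono power_mono) auto
      moreover have "2 * (2+5/4) \<le> (2+w*t^2)*(2+w)"
        using t w by (intro mult_mono) auto
      ultimately show ?thesis by (simp add: power2_eq_square)
    qed
    ultimately show ?thesis by (simp add: G1_def)
  qed
  \<comment> \<open>Replacing t by -t exchanges u and w and turns \<open>G1\<close> into
    \<open>G2\<close>. The linear term is now positive, so bounding t^2 and t^3 by multiples of t
    suffices.\<close>
  moreover have "0 \<le> G2"
  proof -
    have *: "u^2*(1+t)^2 - (2-u*t^2)*(2-u) = 1/16 + 13/200*t - 547/1250*t^2 - 272/625*t^3"
      unfolding u_def by algebra
    have "t^2 \<le> 363/1000*t"
      using mult_right_mono[OF t(2) t(1)] by (simp only: power2_eq_square)
    then have "0 \<le> u^2*(1+t)^2 - (2-u*t^2)*(2-u)"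
      unfolding * using t t3 by (simp add: power2_eq_square)
    moreover have "0 \<le> (2+u*t^2)*(2+u) - u^2*(1-t)^2"
    proof -
      have "u^2*(1-t)^2 \<le> (5/4)^2 * 1^2"
        using t u by (intro mult_mono power_mono) auto
      moreover have "2 * (2+1) \<le> (2+u*t^2)*(2+u)"
        using t u by (intro mult_mono) auto
      ultimately show ?thesis by (simp add: power2_eq_square)
    qed
    ultimately show ?thesis by (simp add: G2_def)
  qed
  ultimately have 1: "0 \<le> (1+C)/2*G1 + (1-C)/2*G2"
    using C by simp
  have "0 \<le> q2 - q3"
  proof -
    have p: "t^8 \<le> (363/1000)^4*t^4" "t^10 \<le> (363/1000)^6*t^4"
      using t power_mono[of t "363/1000" 4] power_mono[of t "363/1000" 6] mult_right_mono[of "t^4" _ "t^4"]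
        mult_right_mono[of "t^6" _ "t^4"] by (auto simp flip: power_add)
    \<comment> \<open>The square is rounded from the leading coefficients of \<open>q2 - q3\<close>:
      its t^3 coefficient 159/100 exceeds 4913/3125, while the t^2 and t^4 coefficients stay below
      those of \<open>q2\<close>, with room for the t^8 and t^10 terms.\<close>
    have "0 \<le> 3/2*(t-53/100)^2*t^2 + 1/5*t^2"
      by (intro add_nonneg_nonneg mult_nonneg_nonneg) auto
    moreover have "0 \<le> t^6" "0 \<le> t^4" by auto
    moreover have "3/2*(t-53/100)^2*t^2 = 3/2*t^4 - 159/100*t^3 + 8427/20000*t^2"
      by (simp add: algebra_simps power2_eq_square power3_eq_cube power4_eq_xxxx)
    moreover have "(363/1000)^4*t^4 \<le> 1/50*t^4" "(363/1000)^6*t^4 \<le> 1/50*t^4"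
      by (intro mult_right_mono; simp add: power_divide)+
    ultimately show ?thesis using p t2 t3 unfolding q2_def q3_def by linarith
  qed
  moreover have "\<bar>q3*C\<bar> \<le> q3"
    using C t by (auto simp: q3_def abs_mult mult_left_le_one_le)
  moreover have "0 \<le> q4*C^2" "0 \<le> q4" by (simp_all add: q4_def)
  ultimately have "0 \<le> q2 + q4 + q4*C^2 - q3*C"
    by linarith
  moreover have "0 \<le> 1 - C^2"
    using C by (simp add: abs_square_le_1)
  ultimately have 2: "0 \<le> (1-C^2)*(q2 + q4 + q4*C^2 - q3*C)" by simp
  have "e*(d^2 - e) - m*d*(d^2 - 2*e) = (1-C^2)*(q2 + q4 + q4*C^2 - q3*C) + ((1+C)/2*G1 + (1-C)/2*G2)"
    unfolding G1_def G2_def q2_def q3_def q4_def d_def e_def m_def u_def w_def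
    by algebra
  with 1 2 show ?thesis by simp
qed

text \<open>The gap is minus the determinant of the tridiagonal matrix with diagonal m, d, d, d and
  off-diagonal entries -b. A nonpositive determinant excludes positive definiteness, and both cases
  give an explicit vector.\<close>

lemma path_form_nonneg:
  fixes b d m :: real
  assumes "0 \<le> b" and gap: "0 \<le> b^2*(d^2 - b^2) - m*d*(d^2 - 2*b^2)"
  obtains g0 g1 g2 g3 where "(g0, g1, g2, g3) \<noteq> (0, 0, 0, 0)"
    and "0 \<le> 2*b*(g0*g1 + g1*g2 + g2*g3) - d*(g1^2 + g2^2 + g3^2) - m*g0^2"
proof (cases "d \<le> sqrt 2 * b")
  case True
  \<comment> \<open>The lower 3 by 3 block has least eigenvalue \<open>d - sqrt 2 * b\<close>, with
    eigenvector (1, sqrt 2, 1).\<close>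
  show ?thesis
    by (rule that[of 0 1 "sqrt 2" 1]) (use True in \<open>auto simp: algebra_simps\<close>)
next
  case False
  then have "0 \<le> sqrt 2 * b" "sqrt 2 * b < d" using assms(1) by auto
  then have "(sqrt 2 * b)^2 < d^2" "0 < d" by (auto intro: power_strict_mono)
  then have pos: "0 < d*(d^2 - 2*b^2)" by (simp add: power_mult_distrib)
  \<comment> \<open>Solving the three-term recursion from the bottom row leaves a residual in the first row only.\<close>
  have "2*b*(g0*g1 + g1*g2 + g2*g3) - d*(g1^2 + g2^2 + g3^2) - m*g0^2
      = g0 * (b^2*(d^2 - b^2) - m*d*(d^2 - 2*b^2))"
    if "g0 = d*(d^2 - 2*b^2)" "g1 = b*(d^2 - b^2)" "g2 = d*b^2" "g3 = b^3" for g0 g1 g2 g3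
    unfolding that by algebra
  with pos gap show ?thesis
    by (intro that[of "d*(d^2 - 2*b^2)" "b*(d^2 - b^2)" "d*b^2" "b^3"]) auto
qed

section \<open>Trial vectors for the numerical range\<close>

lemma vector_4 [simp]:
  "(vector [a, b, c, d] :: 'a::zero ^ 4) $ 1 = a"
  "(vector [a, b, c, d] :: 'a::zero ^ 4) $ 2 = b"
  "(vector [a, b, c, d] :: 'a::zero ^ 4) $ 3 = c"
  "(vector [a, b, c, d] :: 'a::zero ^ 4) $ 4 = d"
  unfolding vector_def by simp_all

lemma cinner_self: "cinner x x = of_real ((norm x)^2)"
proof -
  have "(norm x)^2 = (\<Sum>i\<in>UNIV. (cmod (x $ i))^2)"
    by (simp add: norm_vec_def L2_set_def sum_nonneg)
  then show ?thesis
    by (simp only: of_real_sum complex_norm_square cinner_def)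
qed

lemma A_mat_mult:
  "A_mat t *v x = vector [x$2 - t * x$3 + t^2 * x$4, x$3 - t * x$4, x$4, 0]"
  by (simp add: vec_eq_iff forall_4 matrix_vector_mult_def sum_4 A_mat_def)

text \<open>For x = (1 + t N) y one has A_t x = N y, so the inner product is <Ny, y> + t |Ny|^2.
  With y_k = \<omega>^k g_k the phase enters the comparison only through h Re (z \<omega>), and the
  best phase leaves the form of \<open>path_form_nonneg\<close>.\<close>

lemma A_mat_support:
  fixes t C D m :: real and \<eta> :: complex
  assumes "cmod \<eta> = 1" "Re \<eta> = C"
  defines "b \<equiv> cmod (D * cnj \<eta> - of_real (2*m*t)) / 2"
  defines "d \<equiv> m*(1+t^2) - t*C*D"
  assumes gap: "0 \<le> b^2*(d^2 - b^2) - m*d*(d^2 - 2*b^2)"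
  obtains x where "x \<noteq> 0" "m * (norm x)^2 \<le> D * Re (cnj \<eta> * cinner (A_mat t *v x) x)"
proof -
  have "0 \<le> b" by (simp add: b_def)
  then obtain g0 g1 g2 g3 where v: "(g0, g1, g2, g3) \<noteq> (0, 0, 0, 0)"
    "0 \<le> 2*b*(g0*g1 + g1*g2 + g2*g3) - d*(g1^2 + g2^2 + g3^2) - m*g0^2"
    using path_form_nonneg[OF _ gap] by blast
  define z where "z = D * cnj \<eta> - of_real (2*m*t)"
  \<comment> \<open>This phase makes z \<omega> = |z|, the largest possible real part; for z = 0 any
    phase serves.\<close>
  define \<omega> where "\<omega> = (if z = 0 then 1 else cnj z / cmod z)"
  have \<omega>: "cmod \<omega> = 1" "z * \<omega> = 2*b"
  proof -
    show "cmod \<omega> = 1" by (auto simp: \<omega>_def norm_divide)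
    have "z * \<omega> = cmod z"
      using complex_norm_square[of z] by (auto simp: \<omega>_def field_simps power2_eq_square)
    then show "z * \<omega> = 2*b" by (simp add: b_def z_def)
  qed
  define h q where "h = g0*g1 + g1*g2 + g2*g3" and "q = g1^2 + g2^2 + g3^2"
  \<comment> \<open>The coordinates of (1 + t N) y.\<close>
  define x :: "complex ^ 4" where
    "x = vector [g0 + t*\<omega>*g1, \<omega>*g1 + t*\<omega>^2*g2, \<omega>^2*g2 + t*\<omega>^3*g3, \<omega>^3*g3]"
  have cc: "\<omega> * cnj \<omega> = 1" using \<omega>(1) by (simp add: complex_norm_square[symmetric])
  show ?thesis
  proof (rule that)
    show "x \<noteq> 0"
      using v(1) \<omega>(1) by (auto simp: x_def vec_eq_iff forall_4)
    have 1: "cinner (A_mat t *v x) x = \<omega>*h + t*q"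
      unfolding A_mat_mult cinner_def sum_4 x_def h_def q_def
      by simp (use cc in algebra)
    have 2: "(norm x)^2 = g0^2 + q*(1+t^2) + 2*t*h*Re \<omega>"
    proof -
      have "(norm x)^2 = cinner x x"
        by (simp only: cinner_self)
      also have "\<dots> = g0^2 + q*(1+t^2) + t*h*(\<omega> + cnj \<omega>)"
        unfolding A_mat_mult cinner_def sum_4 x_def h_def q_def
        by simp (use cc in algebra)
      finally show ?thesis
        by (simp add: complex_add_cnj flip: of_real_power of_real_mult of_real_add)
    qed
    have "D * Re (cnj \<eta> * (\<omega>*h + t*q)) - m * (g0^2 + q*(1+t^2) + 2*t*h*Re \<omega>)
        = h * Re (z * \<omega>) - d*q - m*g0^2"
      unfolding z_def d_def assms(2)[symmetric] by (simp add: algebra_simps)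
    also have "\<dots> \<ge> 0"
      using v(2) unfolding \<omega>(2) by (simp add: h_def q_def mult_ac)
    finally show "m * (norm x)^2 \<le> D * Re (cnj \<eta> * cinner (A_mat t *v x) x)"
      unfolding 1 2 by simp
  qed
qed

section \<open>Convexity of the numerical range\<close>

lemma cinner_add_left: "cinner (x + y) z = cinner x z + cinner y z"
  and cinner_add_right: "cinner z (x + y) = cinner z x + cinner z y"
  and cinner_scale_left: "cinner (k *s x) z = k * cinner x z"
  and cinner_scale_right: "cinner z (k *s x) = cnj k * cinner z x"
  by (simp_all add: cinner_def sum.distrib sum_distrib_left algebra_simps)

lemma norm_smult_vec: "norm (k *s x) = cmod k * norm (x :: complex ^ 'n)"
  by (simp add: norm_vec_def L2_set_def norm_mult power_mult_distrib real_sqrt_mult flip: sum_distrib_left)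

lemma rayleigh_in_numerical_range:
  assumes "x \<noteq> 0"
  shows "cinner (A *v x) x / of_real ((norm x)^2) \<in> numerical_range A"
proof -
  define k :: complex where "k = 1 / norm x"
  have "norm (k *s x) = 1"
    using assms by (simp add: k_def norm_smult_vec norm_divide)
  moreover have "cinner (A *v (k *s x)) (k *s x) = cinner (A *v x) x / of_real ((norm x)^2)"
    by (simp add: vector_scalar_commute cinner_scale_left cinner_scale_right k_def power2_eq_square)
  ultimately show ?thesis
    unfolding numerical_range_def by (metis (mono_tags, lifting) mem_Collect_eq)
qed

text \<open>Toeplitz-Hausdorff: after an affine normalization and a phase change the form is real
  along the segment from \<omega> x to y, and the intermediate value theorem applies to its Rayleigh
  quotient.\<close>

lemma convex_numerical_range: "convex (numerical_range A)"
proof (rule convexI)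
  fix a b :: complex and p l :: real
  assume a: "a \<in> numerical_range A" and b: "b \<in> numerical_range A" and pl: "0 \<le> p" "0 \<le> l" "p + l = 1"
  show "p *\<^sub>R a + l *\<^sub>R b \<in> numerical_range A"
  proof (cases "a = b")
    case True
    with a pl show ?thesis by (simp flip: scaleR_left_distrib)
  next
    case False
    obtain x y where x: "norm x = 1" "a = cinner (A *v x) x" and y: "norm y = 1" "b = cinner (A *v y) y"
      using a b by (auto simp: numerical_range_def)
    \<comment> \<open>The affine map carrying a to 0 and b to 1 reduces the claim to a = 0, b = 1.\<close>
    define f where "f v = (cinner (A *v v) v - a * cinner v v) / (b - a)" for v
    define g where "g v z = (cinner (A *v v) z - a * cinner v z) / (b - a)" for v z
    have f0: "f x = 0" and f1: "f y = 1"
      using False x y by (auto simp: f_def cinner_self)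
    have f_scale: "f (k *s v) = k * cnj k * f v" for k v
      unfolding f_def by (simp add: vector_scalar_commute cinner_scale_left cinner_scale_right field_simps)
    have f_comb: "f (k *s x + j *s y) = j * cnj j + k * cnj j * g x y + j * cnj k * g y x" for k j
    proof -
      have "f (k *s x + j *s y) = k * cnj k * f x + j * cnj j * f y + k * cnj j * g x y + j * cnj k * g y x"
        unfolding f_def g_def using False
        by (simp add: vector_scalar_commute cinner_scale_left cinner_scale_right matrix_vector_right_distrib
            cinner_add_left cinner_add_right divide_simps) (simp add: algebra_simps)
      then show ?thesis by (simp add: f0 f1)
    qed
    \<comment> \<open>The phase making f real along the segment from \<omega> x to y.\<close>
    define z where "z = g x y - cnj (g y x)"
    define \<omega> where "\<omega> = (if z = 0 then 1 else cnj z / cmod z)"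
    have \<omega>: "cmod \<omega> = 1" by (auto simp: \<omega>_def norm_divide)
    have "Im (\<omega> * z) = 0"
      by (simp add: \<omega>_def Im_divide_of_real)
    then have im: "Im (\<omega> * g x y + cnj \<omega> * g y x) = 0"
      by (simp add: z_def algebra_simps)
    define v where "v s = of_real (1 - s) * \<omega> *s x + of_real s *s y" for s
    have fv: "f (v s) = of_real (s^2 + s * (1 - s) * Re (\<omega> * g x y + cnj \<omega> * g y x))" for s
    proof -
      have "f (v s) = of_real s^2 + of_real (s * (1 - s)) * (\<omega> * g x y + cnj \<omega> * g y x)"
        unfolding v_def f_comb by (simp add: algebra_simps power2_eq_square)
      also have "\<omega> * g x y + cnj \<omega> * g y x = of_real (Re (\<omega> * g x y + cnj \<omega> * g y x))"
        using im by (simp add: complex_eq_iff)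
      finally show ?thesis by (simp only: of_real_add of_real_mult of_real_power)
    qed
    \<comment> \<open>Otherwise y would be a multiple of x, and f y would vanish together with f
      x.\<close>
    have v0: "v s \<noteq> 0" for s
    proof
      assume v: "v s = 0"
      show False
      proof (cases "s = 0")
        case True
        with v x \<omega> norm_smult_vec[of \<omega> x] show ?thesis by (auto simp: v_def)
      next
        case False
        have "y = (- of_real (1 - s) * \<omega> / of_real s) *s x"
          using v False by (simp add: v_def vec_eq_iff field_simps add_eq_0_iff)
        then have "f y = 0" by (metis f_scale f0 mult_zero_right)
        with f1 show ?thesis by simp
      qed
    qed
    define h where "h s = Re (f (v s)) / (norm (v s))^2" for s
    have "continuous_on {0..1} v"
      unfolding v_def vector_scalar_mult_def
      by (intro continuous_intros continuous_on_vec_lambda)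
    then have "continuous_on {0..1} h"
      unfolding h_def fv Re_complex_of_real using v0
      by (intro continuous_intros) auto
    moreover have "h 0 \<le> l" "l \<le> h 1"
      using pl f0 f1 y by (auto simp: h_def v_def f_scale)
    ultimately obtain s where s: "h s = l"
      using IVT'[of h 0 l 1] by auto
    have "f (v s) = of_real (Re (f (v s)))"
      by (simp only: fv Re_complex_of_real)
    also have "Re (f (v s)) = l * (norm (v s))^2"
      using v0[of s] unfolding s[symmetric] h_def by simp
    finally have "f (v s) = of_real (l * (norm (v s))^2)" .
    then have "cinner (A *v v s) (v s) = (a + (b - a) * l) * (norm (v s))^2"
    proof -
      assume *: "f (v s) = of_real (l * (norm (v s))^2)"
      have "cinner (A *v v s) (v s) = a * cinner (v s) (v s) + (b - a) * f (v s)"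
        using False by (simp add: f_def)
      then show ?thesis unfolding * cinner_self by (simp add: algebra_simps)
    qed
    then have "cinner (A *v v s) (v s) / of_real ((norm (v s))^2) = a + (b - a) * l"
      using v0[of s] by simp
    also have "\<dots> = p *\<^sub>R a + l *\<^sub>R b"
    proof -
      have "p = 1 - l" using pl(3) by simp
      show ?thesis unfolding \<open>p = 1 - l\<close> by (simp add: scaleR_conv_of_real algebra_simps)
    qed
    finally show ?thesis
      using rayleigh_in_numerical_range[OF v0[of s], of A] by simp
  qed
qed

section \<open>A disc inside the numerical range\<close>

text \<open>A point of the ball outside W is separated from W by a hyperplane, whose unit normal
  pointing away from W contradicts \<open>supp\<close>.\<close>

lemma cball_subset_of_support:
  fixes W :: "'a::euclidean_space set"
  assumes "convex W" "closed W" and supp: "\<And>\<eta>. norm \<eta> = 1 \<Longrightarrow> \<exists>w\<in>W. inner \<eta> c + r \<le> inner \<eta> w"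
  shows "cball c r \<subseteq> W"
proof
  fix z assume z: "z \<in> cball c r"
  show "z \<in> W"
  proof (rule ccontr)
    assume "z \<notin> W"
    with assms obtain a b where ab: "inner a z < b" "\<forall>x\<in>W. b < inner a x"
      using separating_hyperplane_closed_point by blast
    \<comment> \<open>Any basis vector is an admissible direction; once W is nonempty, the normal a
      cannot be 0.\<close>
    have "W \<noteq> {}"
      using supp[of "SOME i. i \<in> Basis"] by (auto simp: some_in_eq)
    with ab have "a \<noteq> 0" by auto
    define \<eta> where "\<eta> = - (a /\<^sub>R norm a)"
    have \<eta>: "norm \<eta> = 1" using \<open>a \<noteq> 0\<close> by (simp add: \<eta>_def)
    obtain w where w: "w \<in> W" "inner \<eta> c + r \<le> inner \<eta> w" using supp[OF \<eta>] by blast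
    have "inner \<eta> (z - c) \<le> r"
      using norm_cauchy_schwarz[of \<eta> "z - c"] \<eta> z by (simp add: dist_norm norm_minus_commute)
    with w have "inner \<eta> z \<le> inner \<eta> w" by (simp add: inner_diff_right)
    then have "inner a w \<le> inner a z" using \<open>a \<noteq> 0\<close> by (simp add: \<eta>_def)
    with ab w show False by force
  qed
qed

text \<open>In direction \<eta> the disc has support value m / D, which the Rayleigh quotient of the
  trial vector reaches.\<close>

lemma cball_subset_numerical_range_A_mat:
  assumes t: "0 \<le> t" "t \<le> 363/1000"
  defines "\<kappa> \<equiv> 17*t/25"
  defines "D \<equiv> (5/4)^2 - \<kappa>^2"
  shows "cball (of_real (- \<kappa> / D)) (5/4 / D) \<subseteq> numerical_range (A_mat t)"
proof (rule cball_subset_of_support)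
  fix \<eta> :: complex
  assume \<eta>: "norm \<eta> = 1"
  define C where "C = Re \<eta>"
  define m where "m = 5/4 - \<kappa>*C"
  have C: "\<bar>C\<bar> \<le> 1" using abs_Re_le_cmod[of \<eta>] \<eta> by (simp add: C_def)
  have D: "D = (5/4 - \<kappa>) * (5/4 + \<kappa>)" by (simp add: D_def power2_eq_square algebra_simps)
  have "D > 0" using t by (simp add: D \<kappa>_def)
  \<comment> \<open>The left side is b^2 in \<open>A_mat_support\<close>, the right side e in
    \<open>support_gap_poly\<close> with D = u w.\<close>
  have "(cmod (D * cnj \<eta> - of_real (2*m*t)) / 2)^2 = D^2/4 + m*t*(m*t - C*D)"
  proof -
    have "(cmod (D * cnj \<eta> - of_real (2*m*t)))^2 = (D*Re \<eta> - 2*m*t)^2 + (D*Im \<eta>)^2"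
      by (simp add: cmod_power2)
    also have "\<dots> = D^2 * ((Re \<eta>)^2 + (Im \<eta>)^2) + 4*m*t*(m*t - C*D)"
      unfolding C_def by algebra
    also have "(Re \<eta>)^2 + (Im \<eta>)^2 = 1"
      using \<eta> by (metis cmod_power2 power_one)
    finally show ?thesis by (simp add: power_divide)
  qed
  then obtain x where x: "x \<noteq> 0" "m * (norm x)^2 \<le> D * Re (cnj \<eta> * cinner (A_mat t *v x) x)"
    using A_mat_support[OF \<eta> C_def[symmetric], of D m t] support_gap_poly[OF t C]
    unfolding m_def \<kappa>_def D by metis
  define w where "w = cinner (A_mat t *v x) x / of_real ((norm x)^2)"
  have "inner \<eta> w = Re (cnj \<eta> * cinner (A_mat t *v x) x) / (norm x)^2"
    by (simp add: w_def inner_complex_def add_divide_distrib flip: of_real_power)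
  then have "m * (norm x)^2 \<le> (D * inner \<eta> w) * (norm x)^2"
    using x by simp
  then have "m \<le> D * inner \<eta> w"
    using x(1) by (simp only: mult_le_cancel_right) simp
  then have "m / D \<le> inner \<eta> w"
    using \<open>D > 0\<close> by (simp add: field_simps)
  moreover have "inner \<eta> (of_real (- \<kappa> / D)) + 5/4 / D = m / D"
    by (simp add: m_def C_def inner_complex_def diff_divide_distrib)
  ultimately show "\<exists>w\<in>numerical_range (A_mat t). inner \<eta> (of_real (- \<kappa> / D)) + 5/4 / D \<le> inner \<eta> w"
    using rayleigh_in_numerical_range[OF x(1)] unfolding w_def by metis
qed (simp_all add: convex_numerical_range compact_numerical_range compact_imp_closed)

section \<open>Orthogonality on the unit circle\<close>

text \<open>Cauchy's theorem with 2 pi i divided out; the derivative of the path supplies the factor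
  \<open>circlepath 0 1 x\<close>.\<close>

lemma has_integral_circle_holomorphic:
  assumes "F holomorphic_on S" "open S" "convex S" "cball 0 1 \<subseteq> S"
  shows "((\<lambda>x. circlepath 0 1 x * F (circlepath 0 1 x)) has_integral 0) {0..1}"
proof -
  have "(F has_contour_integral 0) (circlepath 0 1)"
    using assms by (intro Cauchy_theorem_convex_simple) auto
  then have "((\<lambda>x. F (circlepath 0 1 x) * vector_derivative (circlepath 0 1) (at x)) has_integral 0) {0..1}"
    by (simp add: has_contour_integral)
  then have "((\<lambda>x. 1 / (2 * of_real pi * \<i>) * (F (circlepath 0 1 x) * vector_derivative (circlepath 0 1) (at x)))
      has_integral 1 / (2 * of_real pi * \<i>) * 0) {0..1}"
    by (rule has_integral_mult_right)
  then show ?thesis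
    unfolding vector_derivative_circlepath by (simp add: circlepath mult_ac)
qed

text \<open>On the circle conjugation is inversion, so for j < i the integrand is v * v^k with mean
  zero; the case i < j follows by conjugation.\<close>

lemma has_integral_circle_power_cnj_power:
  fixes i j :: nat
  shows "((\<lambda>x. circlepath 0 1 x ^ i * cnj (circlepath 0 1 x ^ j)) has_integral (if i = j then 1 else 0)) {0..1}"
proof -
  have cc: "circlepath 0 1 x * cnj (circlepath 0 1 x) = 1" for x
    by (simp add: circlepath exp_cnj flip: exp_add)
  have gt: "((\<lambda>x. circlepath 0 1 x ^ i * cnj (circlepath 0 1 x ^ j)) has_integral 0) {0..1}" if "j < i" for i j
  proof -
    obtain k where k: "i = Suc k + j" using \<open>j < i\<close> by (metis add.commute add_Suc_right less_iff_Suc_add)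
    have "circlepath 0 1 x ^ i * cnj (circlepath 0 1 x ^ j) = circlepath 0 1 x * circlepath 0 1 x ^ k" for x
    proof -
      have "circlepath 0 1 x ^ i * cnj (circlepath 0 1 x ^ j)
          = circlepath 0 1 x ^ Suc k * (circlepath 0 1 x * cnj (circlepath 0 1 x)) ^ j"
        by (simp add: k power_add power_mult_distrib mult_ac)
      then show ?thesis unfolding cc by simp
    qed
    then show ?thesis
      using has_integral_circle_holomorphic[of "\<lambda>v. v ^ k" UNIV] by (simp add: holomorphic_intros)
  qed
  consider "i = j" | "j < i" | "i < j" by linarith
  then show ?thesis
  proof cases
    case 1
    have "circlepath 0 1 x ^ j * cnj (circlepath 0 1 x ^ j) = 1" for x
      using cc[of x] by (metis complex_cnj_power power_mult_distrib power_one)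
    with 1 show ?thesis using has_integral_const_real[of "1::complex" 0 1] by simp
  next
    case 2
    with gt show ?thesis by simp
  next
    case 3
    from gt[OF 3] have "((\<lambda>x. cnj (circlepath 0 1 x ^ j * cnj (circlepath 0 1 x ^ i))) has_integral cnj 0) {0..1}"
      by (subst has_integral_cnj[symmetric]) (simp add: o_def)
    with 3 show ?thesis by (simp add: mult.commute)
  qed
qed

text \<open>Parseval: only the diagonal of the expanded square survives integration.\<close>

lemma has_integral_circle_norm_poly:
  "((\<lambda>x. (cmod (\<Sum>i<n. c i * circlepath 0 1 x ^ i))^2) has_integral (\<Sum>i<n. (cmod (c i))^2)) {0..1}"
proof -
  let ?e = "circlepath 0 1"
  have "((\<lambda>x. \<Sum>i<n. \<Sum>j<n. (c i * cnj (c j)) * (?e x ^ i * cnj (?e x ^ j)))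
      has_integral (\<Sum>i<n. \<Sum>j<n. (c i * cnj (c j)) * (if i = j then 1 else 0))) {0..1}"
    by (intro has_integral_sum has_integral_mult_right has_integral_circle_power_cnj_power) auto
  also have "(\<lambda>x. \<Sum>i<n. \<Sum>j<n. (c i * cnj (c j)) * (?e x ^ i * cnj (?e x ^ j)))
      = (\<lambda>x. of_real ((cmod (\<Sum>i<n. c i * ?e x ^ i))^2))"
    unfolding complex_norm_square by (simp add: sum_product mult_ac)
  also have "(\<Sum>i<n. \<Sum>j<n. (c i * cnj (c j)) * (if i = j then 1 else 0)) = of_real (\<Sum>i<n. (cmod (c i))^2)"
    by (simp only: of_real_sum complex_norm_square) (simp add: if_distrib sum.delta cong: if_cong)
  finally have "((\<lambda>x. Re (of_real ((cmod (\<Sum>i<n. c i * ?e x ^ i))^2))) has_integral Re (of_real (\<Sum>i<n. (cmod (c i))^2))) {0..1}"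
    by (rule has_integral_Re)
  then show ?thesis by (simp only: Re_complex_of_real)
qed

text \<open>On the circle v^n H is orthogonal to the polynomial Y with coefficients d, so |Y|^2 has
  the same mean as the real part of (cnj Y) f P. Truncating f P below degree n therefore does not
  increase the norm bound M.\<close>

lemma truncated_multiplication_bound:
  fixes c d :: "nat \<Rightarrow> complex"
  assumes H: "H holomorphic_on S" "open S" "convex S" "cball 0 1 \<subseteq> S"
    and eq: "\<And>v. cmod v = 1 \<Longrightarrow> (\<Sum>i<n. d i * v ^ i) = f v * (\<Sum>i<n. c i * v ^ i) + v ^ n * H v"
    and f: "\<And>v. cmod v = 1 \<Longrightarrow> cmod (f v) \<le> M"
  shows "(\<Sum>i<n. (cmod (d i))^2) \<le> M^2 * (\<Sum>i<n. (cmod (c i))^2)"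
proof -
  let ?e = "circlepath 0 1"
  define P where "P v = (\<Sum>i<n. c i * v ^ i)" for v
  define Y where "Y v = (\<Sum>i<n. d i * v ^ i)" for v
  have e: "cmod (?e x) = 1" for x by (simp add: circlepath)
  have "((\<lambda>x. cnj (Y (?e x)) * (?e x ^ n * H (?e x))) has_integral (\<Sum>i<n. cnj (d i) * 0)) {0..1}"
  proof -
    \<comment> \<open>Since i < n, at least one factor v remains after cancellation, as the
      vanishing mean requires.\<close>
    have *: "cnj (?e x) ^ i * ?e x ^ n = ?e x * ?e x ^ (n - i - 1)" if "i < n" for x i
    proof -
      define k where "k = n - i - 1"
      have k: "n = i + Suc k" using that by (simp add: k_def)
      have "cnj (?e x) ^ i * ?e x ^ n = (?e x * cnj (?e x)) ^ i * (?e x * ?e x ^ (n - i - 1))"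
        unfolding k_def[symmetric] by (simp only: k power_add power_mult_distrib power_Suc mult_ac)
      also have "?e x * cnj (?e x) = 1" using e[of x] by (simp add: complex_norm_square[symmetric])
      finally show ?thesis by simp
    qed
    have "((\<lambda>x. \<Sum>i<n. cnj (d i) * (?e x * (?e x ^ (n - i - 1) * H (?e x)))) has_integral (\<Sum>i<n. cnj (d i) * 0)) {0..1}"
      by (intro has_integral_sum has_integral_mult_right has_integral_circle_holomorphic[OF _ H(2-4)]
          holomorphic_intros H(1) finite_lessThan)
    also have "(\<lambda>x. \<Sum>i<n. cnj (d i) * (?e x * (?e x ^ (n - i - 1) * H (?e x))))
        = (\<lambda>x. cnj (Y (?e x)) * (?e x ^ n * H (?e x)))"
    proof (intro ext)
      fix x
      have "cnj (d i) * (?e x * (?e x ^ (n - i - 1) * H (?e x))) = cnj (d i * ?e x ^ i) * (?e x ^ n * H (?e x))"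
        if "i < n" for i
      proof -
        have "cnj (d i) * (?e x * (?e x ^ (n - i - 1) * H (?e x))) = cnj (d i) * (?e x * ?e x ^ (n - i - 1)) * H (?e x)"
          by (simp only: mult.assoc)
        also have "\<dots> = cnj (d i * ?e x ^ i) * (?e x ^ n * H (?e x))"
          unfolding *[OF that, symmetric] by (simp only: complex_cnj_mult complex_cnj_power mult.assoc)
        finally show ?thesis .
      qed
      then show "(\<Sum>i<n. cnj (d i) * (?e x * (?e x ^ (n - i - 1) * H (?e x)))) = cnj (Y (?e x)) * (?e x ^ n * H (?e x))"
        unfolding Y_def cnj_sum sum_distrib_right by (intro sum.cong refl) (simp only: lessThan_iff)
    qed
    finally show ?thesis .
  qed
  then have "((\<lambda>x. cnj (Y (?e x)) * (?e x ^ n * H (?e x))) has_integral 0) {0..1}"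
    by (simp only: mult_zero_right sum.neutral_const)
  from has_integral_Re[OF this]
  have R: "((\<lambda>x. Re (cnj (Y (?e x)) * (?e x ^ n * H (?e x)))) has_integral 0) {0..1}"
    by (simp only: zero_complex.sel)
  have IY: "((\<lambda>x. (cmod (Y (?e x)))^2) has_integral (\<Sum>i<n. (cmod (d i))^2)) {0..1}"
    unfolding Y_def by (rule has_integral_circle_norm_poly)
  have IP: "((\<lambda>x. (cmod (P (?e x)))^2) has_integral (\<Sum>i<n. (cmod (c i))^2)) {0..1}"
    unfolding P_def by (rule has_integral_circle_norm_poly)
  \<comment> \<open>By 2ab <= a^2 + b^2 pointwise; after integration half of the mean of |Y|^2 is
    absorbed on the left.\<close>
  have "(cmod (Y (?e x)))^2 - Re (cnj (Y (?e x)) * (?e x ^ n * H (?e x)))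
      \<le> 1/2 * ((cmod (Y (?e x)))^2 + M^2 * (cmod (P (?e x)))^2)" for x
  proof -
    let ?v = "?e x"
    have "of_real ((cmod (Y ?v))^2) = cnj (Y ?v) * Y ?v" by (simp only: complex_norm_square mult.commute)
    also have "\<dots> = cnj (Y ?v) * (f ?v * P ?v) + cnj (Y ?v) * (?v ^ n * H ?v)"
      unfolding Y_def P_def eq[OF e] by (simp only: distrib_left)
    finally have "Re (of_real ((cmod (Y ?v))^2)) = Re (cnj (Y ?v) * (f ?v * P ?v) + cnj (Y ?v) * (?v ^ n * H ?v))"
      by (rule arg_cong)
    then have "(cmod (Y ?v))^2 - Re (cnj (Y ?v) * (?v ^ n * H ?v)) = Re (cnj (Y ?v) * (f ?v * P ?v))"
      by (simp only: Re_complex_of_real plus_complex.sel)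
    also have "\<dots> \<le> cmod (cnj (Y ?v) * (f ?v * P ?v))" by (rule complex_Re_le_cmod)
    also have "\<dots> \<le> cmod (Y ?v) * (M * cmod (P ?v))"
      unfolding norm_mult complex_mod_cnj using f[OF e] by (intro mult_left_mono mult_right_mono) auto
    also have "\<dots> \<le> 1/2 * ((cmod (Y ?v))^2 + M^2 * (cmod (P ?v))^2)"
      using sum_squares_bound[of "cmod (Y ?v)" "M * cmod (P ?v)"] by (simp add: power_mult_distrib)
    finally show ?thesis .
  qed
  then have "(\<Sum>i<n. (cmod (d i))^2) - 0 \<le> 1/2 * ((\<Sum>i<n. (cmod (d i))^2) + M^2 * (\<Sum>i<n. (cmod (c i))^2))"
    by (rule has_integral_le[OF has_integral_diff[OF IY R]
          has_integral_mult_right[OF has_integral_add[OF IY has_integral_mult_right[OF IP]]]])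
  then show ?thesis by simp
qed

section \<open>A_t as multiplication modulo v^4\<close>

lemma poly_mat_vector:
  "poly_mat p A *v x = (\<Sum>k\<le>degree p. coeff p k *s (mat_power A k *v x))"
proof -
  have "(poly_mat p A *v x) $ i = (\<Sum>k\<le>degree p. coeff p k *s (mat_power A k *v x)) $ i" for i
    by (simp add: poly_mat_def matrix_vector_mult_def sum_distrib_left sum_distrib_right mult.assoc)
      (rule sum.swap)
  then show ?thesis by (simp add: vec_eq_iff)
qed

text \<open>Coordinates in the basis making A_t the multiplication by k; the split of t into 17t/25 + 8t/25 and
  the scaling 4/5 = 1/(5/4) keep the condition number at most 2.\<close>

definition disc_coord :: "real \<Rightarrow> complex ^ 4 \<Rightarrow> nat \<Rightarrow> complex" where
  "disc_coord t x i = [x$4, 4/5 * (x$3 - (8*t/25) * x$4), 16/25 * x$2, 64/125 * (x$1 + (8*t/25) * x$2)] ! i"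

definition disc_poly :: "real \<Rightarrow> complex ^ 4 \<Rightarrow> complex \<Rightarrow> complex" where
  "disc_poly t x v = (\<Sum>i<4. disc_coord t x i * v ^ i)"

definition disc_map :: "real \<Rightarrow> complex \<Rightarrow> complex" where
  "disc_map t v = v / (5/4 + of_real (17*t/25) * v)"

lemma sum_lessThan_4: "(\<Sum>i<4::nat. f i) = f 0 + f 1 + f 2 + (f 3 :: 'a::comm_monoid_add)"
  by (simp add: eval_nat_numeral)

lemma disc_coord_simps:
  "disc_coord t x 0 = x$4" "disc_coord t x 1 = 4/5 * (x$3 - (8*t/25) * x$4)"
  "disc_coord t x 2 = 16/25 * x$2" "disc_coord t x 3 = 64/125 * (x$1 + (8*t/25) * x$2)"
  by (simp_all add: disc_coord_def eval_nat_numeral)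

lemma disc_poly_eq:
  "disc_poly t x v = x$4 + 4/5 * (x$3 - (8*t/25) * x$4) * v + 16/25 * x$2 * v^2
     + 64/125 * (x$1 + (8*t/25) * x$2) * v^3"
  by (simp only: disc_poly_def sum_lessThan_4 disc_coord_simps power_0 power_one_right mult_1_right)

lemma disc_poly_add: "disc_poly t (x + y) v = disc_poly t x v + disc_poly t y v"
  and disc_poly_smult: "disc_poly t (k *s x) v = k * disc_poly t x v"
  and disc_poly_zero: "disc_poly t 0 v = 0"
  unfolding disc_poly_eq vector_add_component vector_smult_component zero_index by algebra+

lemma disc_poly_sum: "finite I \<Longrightarrow> disc_poly t (\<Sum>i\<in>I. f i) v = (\<Sum>i\<in>I. disc_poly t (f i) v)"
  by (induction I rule: finite_induct) (simp_all add: disc_poly_add disc_poly_zero)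

text \<open>Radius 2 provides an open convex neighbourhood of the closed unit disc; there \<kappa>
  |v| stays below 1/2, with \<kappa> = 17t/25.\<close>

lemma disc_map_denominator_nonzero:
  assumes "0 \<le> t" "t \<le> 363/1000" "v \<in> ball 0 2"
  shows "5/4 + of_real (17*t/25) * v \<noteq> (0 :: complex)"
proof
  assume "5/4 + of_real (17*t/25) * v = 0"
  then have "of_real (17*t/25) * v = - of_real (5/4)" by (simp add: add_eq_0_iff)
  then have "cmod (of_real (17*t/25) * v) = 5/4" by (simp only: norm_minus_cancel norm_of_real)
  moreover have "cmod (of_real (17*t/25) * v) \<le> (17*(363/1000)/25) * 2"
    unfolding norm_mult using assms by (intro mult_mono) auto
  ultimately show False by simp
qed

text \<open>After multiplication by the denominator of \<open>disc_map\<close>, the coordinates make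
  all coefficients below degree 4 agree; the v^4 coefficients alone differ and give the
  remainder.\<close>

lemma disc_poly_A_mat:
  assumes t: "0 \<le> t" "t \<le> 363/1000" and v: "v \<in> ball 0 2"
  shows "disc_poly t (A_mat t *v x) v = disc_map t v * disc_poly t x v
    + v^4 * ((of_real (17*t/25) * disc_coord t (A_mat t *v x) 3 - disc_coord t x 3) / (5/4 + of_real (17*t/25) * v))"
proof -
  define d where "d = 5/4 + of_real (17*t/25) * v"
  have "d \<noteq> 0" unfolding d_def by (rule disc_map_denominator_nonzero[OF t v])
  have "d * disc_poly t (A_mat t *v x) v = v * disc_poly t x v
      + v^4 * (of_real (17*t/25) * disc_coord t (A_mat t *v x) 3 - disc_coord t x 3)"
    unfolding disc_poly_eq A_mat_mult disc_coord_simps vector_4 d_def of_real_divide of_real_mult of_real_numeral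
    by algebra
  moreover have "Y = v / d * P + v^4 * (Z / d)" if "d * Y = v * P + v^4 * Z" for Y P Z
    using that \<open>d \<noteq> 0\<close> by (simp add: field_simps)
  ultimately have "disc_poly t (A_mat t *v x) v = v / d * disc_poly t x v
      + v^4 * ((of_real (17*t/25) * disc_coord t (A_mat t *v x) 3 - disc_coord t x 3) / d)"
    by blast
  then show ?thesis unfolding disc_map_def d_def .
qed

text \<open>Congruence modulo v^4 survives multiplication by the holomorphic
  \<open>disc_map t\<close>, so the one-step relation iterates.\<close>

lemma disc_poly_mat_power:
  assumes t: "0 \<le> t" "t \<le> 363/1000"
  shows "\<exists>h. h holomorphic_on ball 0 2 \<and>
    (\<forall>v\<in>ball 0 2. disc_poly t (mat_power (A_mat t) n *v x) v = disc_map t v ^ n * disc_poly t x v + v^4 * h v)"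
proof (induction n)
  case 0
  show ?case by (rule exI[of _ "\<lambda>_. 0"]) auto
next
  case (Suc n)
  then obtain h where h: "h holomorphic_on ball 0 2"
    "\<And>v. v \<in> ball 0 2 \<Longrightarrow> disc_poly t (mat_power (A_mat t) n *v x) v = disc_map t v ^ n * disc_poly t x v + v^4 * h v"
    by blast
  let ?y = "mat_power (A_mat t) n *v x"
  define g where "g v = (of_real (17*t/25) * disc_coord t (A_mat t *v ?y) 3 - disc_coord t ?y 3) / (5/4 + of_real (17*t/25) * v)" for v :: complex
  have "(\<lambda>v. disc_map t v * h v + g v) holomorphic_on ball 0 2"
    unfolding disc_map_def g_def using disc_map_denominator_nonzero[OF t] h(1)
    by (intro holomorphic_intros) auto
  moreover have "disc_poly t (mat_power (A_mat t) (Suc n) *v x) v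
      = disc_map t v ^ Suc n * disc_poly t x v + v^4 * (disc_map t v * h v + g v)" if v: "v \<in> ball 0 2" for v
  proof -
    have "mat_power (A_mat t) (Suc n) *v x = A_mat t *v ?y"
      by (simp add: matrix_vector_mul_assoc)
    then have "disc_poly t (mat_power (A_mat t) (Suc n) *v x) v
        = disc_map t v * (disc_map t v ^ n * disc_poly t x v + v^4 * h v) + v^4 * g v"
      unfolding h(2)[OF v, symmetric] g_def using disc_poly_A_mat[OF t v, of ?y] by (simp only:)
    also have "\<dots> = disc_map t v ^ Suc n * disc_poly t x v + v^4 * (disc_map t v * h v + g v)"
      unfolding power_Suc by algebra
    finally show ?thesis .
  qed
  ultimately show ?case by blast
qed

lemma disc_poly_poly_mat:
  assumes t: "0 \<le> t" "t \<le> 363/1000"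
  obtains h where "h holomorphic_on ball 0 2"
    "\<And>v. v \<in> ball 0 2 \<Longrightarrow> disc_poly t (poly_mat p (A_mat t) *v x) v
       = poly p (disc_map t v) * disc_poly t x v + v^4 * h v"
proof -
  have "\<exists>h. \<forall>n. h n holomorphic_on ball 0 2 \<and> (\<forall>v\<in>ball 0 2.
       disc_poly t (mat_power (A_mat t) n *v x) v = disc_map t v ^ n * disc_poly t x v + v^4 * h n v)"
    by (intro choice allI disc_poly_mat_power t)
  then obtain h where h: "\<And>n. h n holomorphic_on ball 0 2"
    "\<And>n v. v \<in> ball 0 2 \<Longrightarrow>
       disc_poly t (mat_power (A_mat t) n *v x) v = disc_map t v ^ n * disc_poly t x v + v^4 * h n v"
    by blast
  show thesis
  proof (rule that)
    show "(\<lambda>v. \<Sum>k\<le>degree p. coeff p k * h k v) holomorphic_on ball 0 2"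
      by (intro holomorphic_intros h)
    show "disc_poly t (poly_mat p (A_mat t) *v x) v
       = poly p (disc_map t v) * disc_poly t x v + v^4 * (\<Sum>k\<le>degree p. coeff p k * h k v)"
      if "v \<in> ball 0 2" for v
      unfolding poly_mat_vector poly_altdef
      by (simp only: disc_poly_sum[OF finite_atMost] disc_poly_smult h(2)[OF that] sum_distrib_right
          sum_distrib_left sum.distrib distrib_left mult_ac)
  qed
qed

section \<open>The image disc and the condition number\<close>

text \<open>Relative to the centre, \<open>disc_map t v\<close> is the radius times (5/4 v +
  \<kappa>) / (5/4 + \<kappa> v). On the circle the numerator is v times the conjugate of the
  denominator, so the quotient has modulus 1.\<close>

lemma disc_map_in_cball:
  assumes t: "0 \<le> t" "t \<le> 363/1000" and v: "cmod v = 1"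
  defines "\<kappa> \<equiv> 17*t/25"
  defines "D \<equiv> (5/4)^2 - \<kappa>^2"
  shows "disc_map t v \<in> cball (of_real (- \<kappa> / D)) (5/4 / D)"
proof -
  have D: "D > 0"
  proof -
    have "\<kappa>^2 < (5/4)^2" using t by (intro power_strict_mono) (auto simp: \<kappa>_def)
    then show ?thesis by (simp add: D_def)
  qed
  have den: "5/4 + of_real \<kappa> * v \<noteq> 0"
    using disc_map_denominator_nonzero[OF t, of v] v by (simp add: \<kappa>_def)
  have "v * cnj v = 1" using v by (simp add: complex_norm_square[symmetric])
  then have "5/4 * v + of_real \<kappa> = v * cnj (5/4 + of_real \<kappa> * v)"
    by (simp add: algebra_simps)
  then have "cmod (5/4 * v + of_real \<kappa>) = cmod (5/4 + of_real \<kappa> * v)"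
    by (metis complex_mod_cnj mult_1 norm_mult v)
  moreover have "disc_map t v - of_real (- \<kappa> / D) = of_real (5/4 / D) * ((5/4 * v + of_real \<kappa>) / (5/4 + of_real \<kappa> * v))"
  proof -
    define d where "d = 5/4 + of_real \<kappa> * v"
    define E :: complex where "E = of_real D"
    have E: "E = (5/4)^2 - (of_real \<kappa>)^2" by (simp add: D_def E_def)
    have E0: "E \<noteq> 0" using D by (simp add: E_def)
    have d: "d \<noteq> 0" using den by (simp add: d_def)
    have *: "v * E + of_real \<kappa> * d = 5/4 * (5/4 * v + of_real \<kappa>)"
      unfolding E d_def by algebra
    have "v / d + of_real \<kappa> / E = (v * E + of_real \<kappa> * d) / (d * E)"
      by (rule add_frac_eq[OF d E0])
    also have "\<dots> = 5/4 / E * ((5/4 * v + of_real \<kappa>) / d)"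
      unfolding * by (simp add: mult.commute)
    finally have "v / d + of_real \<kappa> / E = 5/4 / E * ((5/4 * v + of_real \<kappa>) / d)" .
    then show ?thesis unfolding disc_map_def \<kappa>_def[symmetric] E_def d_def by simp
  qed
  ultimately have "cmod (disc_map t v - of_real (- \<kappa> / D)) = 5/4 / D"
    using den D by (simp only: norm_mult norm_divide norm_of_real) auto
  then show ?thesis
    by (metis dist_norm dist_commute mem_cball order_refl)
qed

text \<open>At t = 0 the squared scalings run from (64/125)^2 to 1; the slightly wider bounds, of
  ratio 4, leave room for \<beta>. Real and imaginary parts decouple, as do the pairs (x_1, x_2) and
  (x_3, x_4), leaving real forms in two variables.\<close>

lemma disc_coord_bounds:
  assumes t: "0 \<le> t" "t \<le> 363/1000"
  shows "(\<Sum>i<4. (cmod (disc_coord t x i))^2) \<le> 128/125 * (norm x)^2"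
    and "32/125 * (norm x)^2 \<le> (\<Sum>i<4. (cmod (disc_coord t x i))^2)"
proof -
  define \<beta> where "\<beta> = 8*t/25"
  have b: "\<beta>^2 \<le> 135/10000"
  proof -
    have "\<beta>^2 \<le> (8*(363/1000)/25)^2" using t by (intro power_mono) (auto simp: \<beta>_def)
    also have "\<dots> \<le> 135/10000" by (simp add: power2_eq_square)
    finally show ?thesis .
  qed
  have up: "q^2 + (4/5*(p - \<beta>*q))^2 \<le> 128/125*(p^2 + q^2)" for p q :: real
  proof -
    \<comment> \<open>Completing the square in p after scaling by 48/125 = 128/125 - 16/25; the q^2
      coefficient is nonnegative exactly for \<beta>^2 <= 9/640.\<close>
    have "0 \<le> (48/125*p + 16/25*\<beta>*q)^2 + (48/125*(3/125 - 16/25*\<beta>^2) - (16/25)^2*\<beta>^2) * q^2"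
      using b by (intro add_nonneg_nonneg mult_nonneg_nonneg) (auto simp: power2_eq_square)
    also have "\<dots> = 48/125 * (128/125*(p^2 + q^2) - (q^2 + (4/5*(p - \<beta>*q))^2))"
      by algebra
    finally show ?thesis by simp
  qed
  have lo: "32/125*(p^2 + q^2) \<le> (16/25*q)^2 + (64/125*(p + \<beta>*q))^2" for p q :: real
  proof -
    \<comment> \<open>Now the scaling is 96/15625 = (64/125)^2 - 32/125, and the threshold is again
      9/640.\<close>
    have "0 \<le> (96/15625*p + 4096/15625*\<beta>*q)^2 + (96/15625*(96/625 + 4096/15625*\<beta>^2) - (4096/15625)^2*\<beta>^2) * q^2"
      using b by (intro add_nonneg_nonneg mult_nonneg_nonneg) (auto simp: power2_eq_square)
    also have "\<dots> = 96/15625 * ((16/25*q)^2 + (64/125*(p + \<beta>*q))^2 - 32/125*(p^2 + q^2))"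
      by algebra
    finally show ?thesis by simp
  qed
  have up': "(16/25*q)^2 + (64/125*(p + \<beta>*q))^2 \<le> 128/125*(p^2 + q^2)" for p q :: real
  proof -
    have "(p + \<beta>*q)^2 + (p - \<beta>*q)^2 = 2*p^2 + 2*\<beta>^2*q^2" by algebra
    moreover have "\<beta>^2*q^2 \<le> 135/10000*q^2" using b by (intro mult_right_mono) auto
    moreover have "0 \<le> (p - \<beta>*q)^2" "0 \<le> p^2" "0 \<le> q^2" by auto
    moreover have "(16/25*q)^2 = 256/625*q^2" "(64/125*(p + \<beta>*q))^2 = 4096/15625*(p + \<beta>*q)^2"
      by algebra+
    ultimately show ?thesis unfolding distrib_left by linarith
  qed
  have lo': "32/125*(p^2 + q^2) \<le> q^2 + (4/5*(p - \<beta>*q))^2" for p q :: real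
  proof -
    have "0 \<le> (48/125*p - 16/25*\<beta>*q)^2 + (48/125*(93/125 + 16/25*\<beta>^2) - (16/25)^2*\<beta>^2) * q^2"
      using b by (intro add_nonneg_nonneg mult_nonneg_nonneg) (auto simp: power2_eq_square)
    also have "\<dots> = 48/125 * (q^2 + (4/5*(p - \<beta>*q))^2 - 32/125*(p^2 + q^2))"
      by algebra
    finally show ?thesis by simp
  qed
  have n: "(norm x)^2 = ((Re (x$1))^2 + (Re (x$2))^2) + ((Im (x$1))^2 + (Im (x$2))^2)
      + ((Re (x$3))^2 + (Re (x$4))^2) + ((Im (x$3))^2 + (Im (x$4))^2)"
    by (simp add: norm_vec_def L2_set_def sum_4 cmod_power2)
  have s: "(\<Sum>i<4. (cmod (disc_coord t x i))^2)
     = ((16/25*Re (x$2))^2 + (64/125*(Re (x$1) + \<beta>*Re (x$2)))^2)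
     + ((16/25*Im (x$2))^2 + (64/125*(Im (x$1) + \<beta>*Im (x$2)))^2)
     + ((Re (x$4))^2 + (4/5*(Re (x$3) - \<beta>*Re (x$4)))^2)
     + ((Im (x$4))^2 + (4/5*(Im (x$3) - \<beta>*Im (x$4)))^2)"
    unfolding sum_lessThan_4 disc_coord_simps cmod_power2 by (simp add: \<beta>_def)
  have dist: "k * (a + b + c + d) = k * a + k * b + k * c + k * d" for k a b c d :: real
    by (simp only: distrib_left)
  show "(\<Sum>i<4. (cmod (disc_coord t x i))^2) \<le> 128/125 * (norm x)^2"
    unfolding s n dist
    by (intro add_mono up up')
  show "32/125 * (norm x)^2 \<le> (\<Sum>i<4. (cmod (disc_coord t x i))^2)"
    unfolding s n dist
    by (intro add_mono lo lo')
qed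

section \<open>The norm inequality\<close>

theorem theorem1p5:
  fixes t :: real and p :: "complex poly"
  assumes "t \<in> {0..0.363}"
  shows "op_norm (poly_mat p (A_mat t))
           \<le> 2 * (SUP z\<in>numerical_range (A_mat t). cmod (poly p z))"
proof -
  have t: "0 \<le> t" "t \<le> 363/1000" using assms by auto
  define M where "M = (SUP z\<in>numerical_range (A_mat t). cmod (poly p z))"
  have M: "cmod (poly p z) \<le> M" if "z \<in> numerical_range (A_mat t)" for z
    using SUP_numerical_range_attained[of "A_mat t" p] that unfolding M_def by metis
  have M0: "0 \<le> M"
    using M numerical_range_nonempty[of "A_mat t"] norm_ge_zero order_trans by blast
  have "norm (poly_mat p (A_mat t) *v x) \<le> 2 * M * norm x" for x
  proof -
    let ?y = "poly_mat p (A_mat t) *v x"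
    obtain h where h: "h holomorphic_on ball 0 2" "\<And>v. v \<in> ball 0 2 \<Longrightarrow>
        disc_poly t ?y v = poly p (disc_map t v) * disc_poly t x v + v^4 * h v"
      using disc_poly_poly_mat[OF t] by metis
    have "(\<Sum>i<4. (cmod (disc_coord t ?y i))^2) \<le> M^2 * (\<Sum>i<4. (cmod (disc_coord t x i))^2)"
    proof (rule truncated_multiplication_bound[OF h(1)])
      fix v :: complex assume v: "cmod v = 1"
      then show "(\<Sum>i<4. disc_coord t ?y i * v ^ i)
          = poly p (disc_map t v) * (\<Sum>i<4. disc_coord t x i * v ^ i) + v ^ 4 * h v"
        using h(2)[of v] by (simp add: disc_poly_def)
      show "cmod (poly p (disc_map t v)) \<le> M"
        using disc_map_in_cball[OF t v] cball_subset_numerical_range_A_mat[OF t] by (intro M) blast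
    qed auto
    then have "32/125 * (norm ?y)^2 \<le> M^2 * (128/125 * (norm x)^2)"
      using disc_coord_bounds[OF t] by (meson mult_left_mono order_trans zero_le_power2)
    \<comment> \<open>The ratio 4 of the two coordinate bounds becomes the constant 2.\<close>
    then have "(norm ?y)^2 \<le> (2 * M * norm x)^2"
      by (simp add: power_mult_distrib)
    then show ?thesis
      using M0 by (auto intro: power2_le_imp_le)
  qed
  then show ?thesis
    unfolding op_norm_def M_def[symmetric] by (rule onorm_le)
qed

end
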